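(* Let $w^d$ and $w^o$ be the collected trajectories described in the context, and assume $\operatorname{rank}(H_{T_{\mathrm{ini}}+N}(w^d)) = m(T_{\mathrm{ini}}+N)+n$. Suppose two pairs of symmetric positive definite weighting matrices $(Q,R)$ and $(Q',R')$, with $Q,Q'\in\mathbb{R}^{p\times p}$ and $R,R'\in\mathbb{R}^{m\times m}$, both satisfy $$(K_f^T \mathcal{Q} K_f+\mathcal{R})\,\tilde u + K_f^T \mathcal{Q}^T K_p z_{\mathrm{ini}} = 0,$$ where $\mathcal{Q}=\operatorname{diag}(Q,\dots,Q)$ and $\mathcal{R}=\operatorname{diag}(R,\dots,R)$ ($N$ diagonal blocks each; for the second pair $Q,R$ are replaced by $Q',R'$). If $\dim(\mathbb{N}(\tilde\Phi))=1$, where $\mathbb{N}(\cdot)$ denotes the null space, then $Q=\alpha Q'$ and $R=\alpha R'$ for some scalar $\alpha>0$.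
   Context: System: $x_{k+1}=Ax_k+Bu_k$, $y_k=Cx_k+Du_k$ is a minimal LTI system with state dimension $n$, input dimension $m$, output dimension $p$. $\operatorname{col}(\cdot)$ denotes vertical stacking, $\operatorname{diag}$ of matrices denotes the block diagonal matrix, $\dagger$ the Moore-Penrose pseudoinverse, $\otimes$ the Kronecker product. $M(a:b,:)$ is the submatrix of $M$ formed by rows $a$ to $b$. Offline data: $w^d=\{u^d_k,y^d_k\}_{k=0}^{T-1}$ is an input-output trajectory of the system. For a signal $v=\{v_k\}_{k=0}^{T-1}$ the Hankel matrix $\mathcal{H}_L(v)$ has $L$ block rows and $T-L+1$ columns, with $(i,j)$ block $v_{i+j}$ ($0\le i\le L-1$, $0\le j\le T-L$). Partition $\operatorname{col}(U_p,U_f)=\mathcal{H}_{T_{\mathrm{ini}}+N}(u^d)$ and $\operatorname{col}(Y_p,Y_f)=\mathcal{H}_{T_{\mathrm{ini}}+N}(y^d)$, where $U_p,Y_p$ consist of the first $T_{\mathrm{ini}}$ block rows and $U_f,Y_f$ of the last $N$ block rows. $H_{T_{\mathrm{ini}}+N}(w^d)=\operatorname{col}(U_p,Y_p,U_f,Y_f)$. Optimal data: $w^o$ is an input-output trajectory of length $N'=T_{\mathrm{ini}}+N$, optimal for minimizing $\sum_{k=0}^{N'-1}(y_k^TQ_0y_k+u_k^TR_0u_k)$ subject to the system dynamics with a given initial state, where $Q_0,R_0$ are the (unknown) true positive definite weights. It is split into its first $T_{\mathrm{ini}}$ samples, with stacked inputs and outputs $u^{\mathrm{ini}},y^{\mathrm{ini}}$,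 and its last $N$ samples, with stacked inputs $\tilde u=\operatorname{col}(\tilde u_0,\dots,\tilde u_{N-1})$ and outputs $\tilde y=\operatorname{col}(\tilde y_0,\dots,\tilde y_{N-1})$. Put $z_{\mathrm{ini}}=\operatorname{col}(u^{\mathrm{ini}},y^{\mathrm{ini}})$. Define $(K_p\mid K_f)=K=Y_f\,\operatorname{col}(U_p,Y_p,U_f)^\dagger$, where $K_p$ has $(m+p)T_{\mathrm{ini}}$ columns and $K_f$ has $mN$ columns. Let $\tilde y^{es}=K_f\tilde u+K_pz_{\mathrm{ini}}=\operatorname{col}(\tilde y^{es}_0,\dots,\tilde y^{es}_{N-1})$ with $\tilde y^{es}_i\in\mathbb{R}^p$. $\operatorname{vec}$ is column-stacking vectorization and $\operatorname{vech}$ half-vectorization of symmetric matrices. $D_m,D_p$ are the duplication matrices: $D_m\operatorname{vech}(R)=\operatorname{vec}(R)$ and $D_p\operatorname{vech}(Q)=\operatorname{vec}(Q)$ for all symmetric $R\in\mathbb{R}^{m\times m}$, $Q\in\mathbb{R}^{p\times p}$. Then $$\tilde\Phi=\begin{pmatrix}\Phi_y&\Phi_u\end{pmatrix}\operatorname{diag}(D_p,D_m),$$ $$\Phi_y=\sum_{i=0}^{N-1}(\tilde y^{es}_i)^T\otimes \big(K_f(ip+1:(i+1)p,:)\big)^T,\qquad \Phi_u=\sum_{i=0}^{N-1}\tilde u_i^T\otimes \big(I_{mN}(im+1:(i+1)m,:)\big)^T .$$ So $\tilde\Phi$ has size $mN\times\frac12(m^2+m+p^2+p)$. *)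

theory Defs
  imports
    Jordan_Normal_Form.DL_Rank
    Jordan_Normal_Form.Matrix_Kernel
begin

text \<open>Rows \<open>a, \<dots>, b - 1\<close> and columns \<open>a, \<dots>, b - 1\<close>, counted from 0. The submatrix written
  \<open>M(ip+1 : (i+1)p, :)\<close> with 1-based inclusive indices is \<open>row_block M (i*p) ((i+1)*p)\<close>.\<close>

definition row_block :: "'a mat \<Rightarrow> nat \<Rightarrow> nat \<Rightarrow> 'a mat" where
  "row_block M a b = mat (b - a) (dim_col M) (\<lambda>(i, j). M $$ (a + i, j))"

definition col_block :: "'a mat \<Rightarrow> nat \<Rightarrow> nat \<Rightarrow> 'a mat" where
  "col_block M a b = mat (dim_row M) (b - a) (\<lambda>(i, j). M $$ (i, a + j))"

definition append_cols :: "'a::zero mat \<Rightarrow> 'a mat \<Rightarrow> 'a mat" (infixr \<open>@\<^sub>c\<close> 65) where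
  "A @\<^sub>c B = four_block_mat A B (0\<^sub>m 0 (dim_col A)) (0\<^sub>m 0 (dim_col B))"

text \<open>\<open>stack b L v\<close> is the vertical stacking of \<open>v 0, \<dots>, v (L - 1)\<close>, each of dimension \<open>b\<close>,
  and \<open>vec_block b v i\<close> is the \<open>i\<close>-th block of dimension \<open>b\<close> of \<open>v\<close>.\<close>

definition stack :: "nat \<Rightarrow> nat \<Rightarrow> (nat \<Rightarrow> 'a vec) \<Rightarrow> 'a vec" where
  "stack b L v = vec (b * L) (\<lambda>i. v (i div b) $ (i mod b))"

definition vec_block :: "nat \<Rightarrow> 'a vec \<Rightarrow> nat \<Rightarrow> 'a vec" where
  "vec_block b v i = vec b (\<lambda>j. v $ (i * b + j))"

definition row_vector :: "'a vec \<Rightarrow> 'a mat" where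
  "row_vector v = mat_of_rows (dim_vec v) [v]"

definition mat_sum :: "nat \<Rightarrow> nat \<Rightarrow> (nat \<Rightarrow> 'a mat) \<Rightarrow> nat \<Rightarrow> 'a::comm_monoid_add mat" where
  "mat_sum nr nc F N = mat nr nc (\<lambda>ij. \<Sum>k<N. F k $$ ij)"

definition kronecker :: "'a::times mat \<Rightarrow> 'a mat \<Rightarrow> 'a mat" (infixl \<open>\<otimes>\<^sub>K\<close> 70) where
  "A \<otimes>\<^sub>K B = mat (dim_row A * dim_row B) (dim_col A * dim_col B)
     (\<lambda>(i, j). A $$ (i div dim_row B, j div dim_col B) * B $$ (i mod dim_row B, j mod dim_col B))"

text \<open>\<open>hankel b L T v\<close> is the block Hankel matrix \<open>\<H>\<^sub>L(v)\<close> of a signal \<open>v 0, \<dots>, v (T - 1)\<close>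
  of dimension \<open>b\<close>: it has \<open>L\<close> block rows and \<open>T - L + 1\<close> columns.\<close>

definition hankel :: "nat \<Rightarrow> nat \<Rightarrow> nat \<Rightarrow> (nat \<Rightarrow> 'a vec) \<Rightarrow> 'a mat" where
  "hankel b L T v = mat (b * L) (T + 1 - L) (\<lambda>(i, j). v (i div b + j) $ (i mod b))"

definition sym_pos_def :: "nat \<Rightarrow> real mat \<Rightarrow> bool" where
  "sym_pos_def k S \<longleftrightarrow> S \<in> carrier_mat k k \<and> S\<^sup>T = S \<and>
     (\<forall>x \<in> carrier_vec k. x \<noteq> 0\<^sub>v k \<longrightarrow> x \<bullet> (S *\<^sub>v x) > 0)"

text \<open>The Moore-Penrose pseudoinverse of a real matrix, as the unique solution of the four
  Penrose equations.\<close>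

definition pseudoinverse :: "real mat \<Rightarrow> real mat" where
  "pseudoinverse M = (THE X. X \<in> carrier_mat (dim_col M) (dim_row M) \<and>
     M * X * M = M \<and> X * M * X = X \<and> (M * X)\<^sup>T = M * X \<and> (X * M)\<^sup>T = X * M)"

definition vectorize :: "'a mat \<Rightarrow> 'a vec" where
  "vectorize S = vec (dim_row S * dim_col S) (\<lambda>r. S $$ (r mod dim_row S, r div dim_row S))"

text \<open>Positions of the lower triangle of a \<open>k \<times> k\<close> matrix, column by column.\<close>

definition vech_index :: "nat \<Rightarrow> (nat \<times> nat) list" where
  "vech_index k = concat (map (\<lambda>j. map (\<lambda>i. (i, j)) [j..<k]) [0..<k])"

definition vech :: "'a mat \<Rightarrow> 'a vec" where
  "vech S = vec_of_list (map (\<lambda>ij. S $$ ij) (vech_index (dim_row S)))"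

definition duplication_mat :: "nat \<Rightarrow> 'a::zero_neq_one mat" where
  "duplication_mat k = mat (k * k) (length (vech_index k))
     (\<lambda>(r, c). case vech_index k ! c of (i, j) \<Rightarrow> if {i, j} = {r mod k, r div k} then 1 else 0)"

lemma set_vech_index: "set (vech_index k) = {(i, j). j \<le> i \<and> i < k}"
  by (fastforce simp: vech_index_def image_iff)

lemma distinct_vech_index: "distinct (vech_index k)"
proof -
  have "distinct (concat (map (\<lambda>j. map (\<lambda>i. (i, j)) [j..<k]) js))" if "distinct js" for js
    using that by (induction js) (auto simp: distinct_map inj_on_def)
  then show ?thesis by (simp add: vech_index_def)
qed

lemma length_vech_index: "length (vech_index k) = k * (k + 1) div 2"
proof -
  have "length (vech_index k) = (\<Sum>j<k. k - j)"
    by (simp add: vech_index_def length_concat comp_def interv_sum_list_conv_sum_set_nat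
        atLeast0LessThan)
  also have "\<dots> = (\<Sum>j<k. Suc j)"
    by (rule sum.reindex_bij_witness[of _ "\<lambda>j. k - Suc j" "\<lambda>j. k - Suc j"]) auto
  also have "2 * \<dots> = k * (k + 1)"
    by (induction k) auto
  then have "(\<Sum>j<k. Suc j) = k * (k + 1) div 2"
    by simp
  finally show ?thesis .
qed

lemma duplication_mat_carrier: "duplication_mat k \<in> carrier_mat (k * k) (k * (k + 1) div 2)"
  by (simp add: duplication_mat_def length_vech_index)

lemma duplication_mat_vech:
  fixes S :: "'a::comm_semiring_1 mat"
  assumes S: "S \<in> carrier_mat k k" and sym: "S\<^sup>T = S"
  shows "duplication_mat k *\<^sub>v vech S = vectorize S"
proof (rule eq_vecI)
  fix r assume "r < dim_vec (vectorize S)"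
  then have r: "r < k * k" using S by (simp add: vectorize_def)
  define a b where "a = r mod k" and "b = r div k"
  have a: "a < k" using r by (cases k) (auto simp: a_def)
  have b: "b < k" using r by (simp add: b_def less_mult_imp_div_less)
  have sym': "S $$ (i, j) = S $$ (j, i)" if "i < k" "j < k" for i j
    using that S sym by (metis carrier_matD index_transpose_mat(1))
  let ?f = "\<lambda>(i, j). (if {i, j} = {a, b} then 1 else 0) * S $$ (i, j)"
  have "(duplication_mat k *\<^sub>v vech S) $ r = (\<Sum>c = 0..<length (vech_index k). ?f (vech_index k ! c))"
    using r S unfolding duplication_mat_def vech_def a_def b_def
    by (auto simp: scalar_prod_def vec_of_list_index split: prod.splits intro!: sum.cong)
  also have "\<dots> = sum_list (map ?f (vech_index k))"
    by (simp add: sum_list_sum_nth)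
  also have "\<dots> = sum ?f {(i, j). j \<le> i \<and> i < k}"
    by (simp only: sum_list_distinct_conv_sum_set[OF distinct_vech_index] set_vech_index)
  also have "\<dots> = sum ?f {(max a b, min a b)}"
  proof (rule sum.mono_neutral_right)
    show "finite {(i, j). j \<le> i \<and> i < k}"
      using set_vech_index[of k] by (metis List.finite_set)
  qed (use a b in \<open>auto simp: doubleton_eq_iff max_def min_def split: if_splits\<close>)
  also have "\<dots> = S $$ (a, b)"
    using sym'[OF a b] by (auto simp: max_def min_def insert_commute)
  finally show "(duplication_mat k *\<^sub>v vech S) $ r = vectorize S $ r"
    using r S by (simp add: vectorize_def a_def b_def)
qed (use S in \<open>simp add: duplication_mat_def vectorize_def\<close>)

text \<open>Signals are functions on \<open>nat\<close> of which only the values at the first \<open>T\<close> instants matter.\<close>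

definition lti_system ::
  "nat \<Rightarrow> nat \<Rightarrow> nat \<Rightarrow> real mat \<Rightarrow> real mat \<Rightarrow> real mat \<Rightarrow> real mat \<Rightarrow> bool" where
  "lti_system n m p A B C D \<longleftrightarrow>
     A \<in> carrier_mat n n \<and> B \<in> carrier_mat n m \<and> C \<in> carrier_mat p n \<and> D \<in> carrier_mat p m"

definition is_trajectory :: "real mat \<Rightarrow> real mat \<Rightarrow> real mat \<Rightarrow> real mat \<Rightarrow> nat \<Rightarrow>
    real vec \<Rightarrow> (nat \<Rightarrow> real vec) \<Rightarrow> (nat \<Rightarrow> real vec) \<Rightarrow> bool" where
  "is_trajectory A B C D T x0 u y \<longleftrightarrow> x0 \<in> carrier_vec (dim_row A) \<and>
     (\<forall>k<T. u k \<in> carrier_vec (dim_col B)) \<and>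
     (\<exists>x. x 0 = x0 \<and>
       (\<forall>k<T. x (Suc k) = A *\<^sub>v x k + B *\<^sub>v u k \<and> y k = C *\<^sub>v x k + D *\<^sub>v u k))"

definition is_io_trajectory :: "real mat \<Rightarrow> real mat \<Rightarrow> real mat \<Rightarrow> real mat \<Rightarrow> nat \<Rightarrow>
    (nat \<Rightarrow> real vec) \<Rightarrow> (nat \<Rightarrow> real vec) \<Rightarrow> bool" where
  "is_io_trajectory A B C D T u y \<longleftrightarrow> (\<exists>x0. is_trajectory A B C D T x0 u y)"

text \<open>Minimality in the sense of realization theory: no system with the same input-output map from
  the zero initial state (that is, with the same transfer function) has a smaller state dimension.\<close>

definition minimal_lti_system ::
  "nat \<Rightarrow> nat \<Rightarrow> nat \<Rightarrow> real mat \<Rightarrow> real mat \<Rightarrow> real mat \<Rightarrow> real mat \<Rightarrow> bool" where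
  "minimal_lti_system n m p A B C D \<longleftrightarrow> lti_system n m p A B C D \<and>
     (\<forall>n' A' B' C' D'. lti_system n' m p A' B' C' D' \<and>
        (\<forall>T u y. is_trajectory A B C D T (0\<^sub>v n) u y \<longleftrightarrow>
                 is_trajectory A' B' C' D' T (0\<^sub>v n') u y) \<longrightarrow>
        n \<le> n')"

definition quadratic_cost :: "real mat \<Rightarrow> real mat \<Rightarrow> nat \<Rightarrow>
    (nat \<Rightarrow> real vec) \<Rightarrow> (nat \<Rightarrow> real vec) \<Rightarrow> real" where
  "quadratic_cost Q R T u y = (\<Sum>k<T. y k \<bullet> (Q *\<^sub>v y k) + u k \<bullet> (R *\<^sub>v u k))"

definition is_optimal_trajectory :: "real mat \<Rightarrow> real mat \<Rightarrow> real mat \<Rightarrow> real mat \<Rightarrow>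
    real mat \<Rightarrow> real mat \<Rightarrow> nat \<Rightarrow> real vec \<Rightarrow> (nat \<Rightarrow> real vec) \<Rightarrow> (nat \<Rightarrow> real vec) \<Rightarrow> bool" where
  "is_optimal_trajectory A B C D Q R T x0 u y \<longleftrightarrow> is_trajectory A B C D T x0 u y \<and>
     (\<forall>u' y'. is_trajectory A B C D T x0 u' y' \<longrightarrow>
        quadratic_cost Q R T u y \<le> quadratic_cost Q R T u' y')"

definition optimality_condition :: "nat \<Rightarrow> real mat \<Rightarrow> real mat \<Rightarrow> real vec \<Rightarrow> real vec \<Rightarrow>
    real mat \<Rightarrow> real mat \<Rightarrow> bool" where
  "optimality_condition N Kp Kf u z Q R \<longleftrightarrow>
     (let \<Q> = diag_block_mat (replicate N Q); \<R> = diag_block_mat (replicate N R) in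
       (Kf\<^sup>T * \<Q> * Kf + \<R>) *\<^sub>v u + (Kf\<^sup>T * \<Q>\<^sup>T * Kp) *\<^sub>v z = 0\<^sub>v (dim_col Kf))"

definition Phi_y :: "nat \<Rightarrow> nat \<Rightarrow> nat \<Rightarrow> real mat \<Rightarrow> real vec \<Rightarrow> real mat" where
  "Phi_y m p N Kf y = mat_sum (m * N) (p * p)
     (\<lambda>i. row_vector (vec_block p y i) \<otimes>\<^sub>K (row_block Kf (i * p) ((i + 1) * p))\<^sup>T) N"

definition Phi_u :: "nat \<Rightarrow> nat \<Rightarrow> real vec \<Rightarrow> real mat" where
  "Phi_u m N u = mat_sum (m * N) (m * m)
     (\<lambda>i. row_vector (vec_block m u i) \<otimes>\<^sub>K (row_block (1\<^sub>m (m * N)) (i * m) ((i + 1) * m))\<^sup>T) N"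

definition Phi_tilde :: "nat \<Rightarrow> nat \<Rightarrow> nat \<Rightarrow> real mat \<Rightarrow> real vec \<Rightarrow> real vec \<Rightarrow> real mat" where
  "Phi_tilde m p N Kf y u =
     (Phi_y m p N Kf y @\<^sub>c Phi_u m N u) * diag_block_mat [duplication_mat p, duplication_mat m]"

lemma Phi_tilde_carrier:
  "Phi_tilde m p N Kf y u \<in> carrier_mat (m * N) (p * (p + 1) div 2 + m * (m + 1) div 2)"
  using duplication_mat_carrier[of p, where 'a = real] duplication_mat_carrier[of m, where 'a = real]
  by (auto simp: Phi_tilde_def Phi_y_def Phi_u_def mat_sum_def append_cols_def Let_def)

end

theory Submission
  imports Defs
begin

text \<open>
  The matrix \<open>\<Phi>\<close> (\<open>Phi_tilde\<close>) represents the optimality condition as a linear equation in the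
  weights. Since \<open>\<Q>\<close> is symmetric, that condition reads
  \<open>K\<^sub>f\<^sup>T (\<Q> (K\<^sub>f u + K\<^sub>p z)) + \<R> u = 0\<close>, and \<open>K\<^sub>f u + K\<^sub>p z\<close> is the estimated output \<open>y\<close>. Writing
  the block products as sums over the \<open>N\<close> time instants and using
  \<open>vec (B S y) = (y\<^sup>T \<otimes> B) vec S\<close> for a vector \<open>y\<close> turns the left-hand side into
  \<open>\<Phi>\<^sub>y vec Q + \<Phi>\<^sub>u vec R\<close> (lemma \<open>sum_kronecker_mult_vectorize\<close>). The duplication matrices
  replace \<open>vec\<close> by \<open>vech\<close>, so a pair of symmetric weights satisfies the condition iff
  \<open>col (vech Q, vech R)\<close> lies in the kernel of \<open>\<Phi>\<close> (lemma
  \<open>optimality_condition_iff_mat_kernel\<close>).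

  If that kernel is a line, two admissible pairs are therefore proportional, because half-vectorization
  is linear and injective on symmetric matrices. Positive definiteness enters twice: it makes the
  half-vectorized pairs nonzero, so that one is a multiple of the other, and it forces the factor
  to be positive. A one-dimensional kernel also excludes the degenerate case in which inputs
  and outputs both have dimension 0.
\<close>

section \<open>Vectors and matrices in blocks\<close>

lemma sum_lessThan_blocks:
  fixes f :: "nat \<Rightarrow> 'a::comm_monoid_add"
  shows "(\<Sum>r<k * N. f r) = (\<Sum>i<N. \<Sum>j<k. f (i * k + j))"
proof -
  have "(\<Sum>r<k * N. f r) = (\<Sum>i<N. sum f {i * k..<i * k + k})"
    by (simp add: sum.nat_group mult.commute)
  also have "\<dots> = (\<Sum>i<N. \<Sum>j<k. f (i * k + j))"
  proof (rule sum.cong[OF refl])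
    show "sum f {i * k..<i * k + k} = (\<Sum>j<k. f (i * k + j))" for i
      using sum.shift_bounds_nat_ivl[of f 0 "i * k" k] by (simp add: atLeast0LessThan add.commute)
  qed
  finally show ?thesis .
qed

lemma mult_mat_vec_index_sum:
  assumes "A \<in> carrier_mat nr nc" "v \<in> carrier_vec nc" "i < nr"
  shows "(A *\<^sub>v v) $ i = (\<Sum>j<nc. A $$ (i, j) * v $ j)"
  using assms by (auto simp: scalar_prod_def atLeast0LessThan intro!: sum.cong)

lemma block_index_less: "i < N \<Longrightarrow> j < k \<Longrightarrow> i * k + j < k * (N::nat)"
proof -
  assume "i < N" "j < k"
  then have "i * k + j < Suc i * k" by simp
  also have "\<dots> \<le> N * k" using \<open>i < N\<close> by (intro mult_le_mono1) simp
  finally show ?thesis by (simp add: mult.commute)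
qed

lemma diag_block_mat_replicate_carrier [simp]:
  "S \<in> carrier_mat k k \<Longrightarrow> diag_block_mat (replicate N S) \<in> carrier_mat (k * N) (k * N)"
  by (induction N) (auto simp: Let_def)

lemma diag_block_mat_replicate_index:
  assumes S: "S \<in> carrier_mat k k" and "i < k * N" "j < k * N"
  shows "diag_block_mat (replicate N S) $$ (i, j) =
    (if i div k = j div k then S $$ (i mod k, j mod k) else 0)"
  using assms(2,3)
proof (induction N arbitrary: i j)
  case (Suc N)
  have k: "k > 0" using Suc.prems by (cases k) auto
  define D where "D = diag_block_mat (replicate N S)"
  have D: "D \<in> carrier_mat (k * N) (k * N)" using S by (simp add: D_def)
  have IH: "D $$ (i - k, j - k) =
      (if (i - k) div k = (j - k) div k then S $$ ((i - k) mod k, (j - k) mod k) else 0)"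
    if "k \<le> i" "k \<le> j"
    unfolding D_def using Suc.prems that by (intro Suc.IH) auto
  show ?case
    using Suc.prems S D k IH
    by (auto simp: Let_def D_def[symmetric] le_div_geq le_mod_geq not_less div_eq_0_iff)
qed simp

lemma diag_block_mat_replicate_mult_block:
  assumes S: "S \<in> carrier_mat k k" and v: "v \<in> carrier_vec (k * N)" and i: "i < N"
  shows "vec_block k (diag_block_mat (replicate N S) *\<^sub>v v) i = S *\<^sub>v vec_block k v i"
proof (rule eq_vecI)
  fix a assume "a < dim_vec (S *\<^sub>v vec_block k v i)"
  then have a: "a < k" using S by simp
  have less: "i * k + a < k * N" using i a by (rule block_index_less)
  have "(diag_block_mat (replicate N S) *\<^sub>v v) $ (i * k + a) =
      (\<Sum>c<k * N. diag_block_mat (replicate N S) $$ (i * k + a, c) * v $ c)"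
    using S v less by (intro mult_mat_vec_index_sum) auto
  also have "\<dots> = (\<Sum>c<k * N. (if i = c div k then S $$ (a, c mod k) else 0) * v $ c)"
    using S less a by (intro sum.cong) (auto simp: diag_block_mat_replicate_index)
  also have "\<dots> = (\<Sum>l<N. \<Sum>c<k. if i = l then S $$ (a, c) * v $ (l * k + c) else 0)"
    unfolding sum_lessThan_blocks by (intro sum.cong refl) auto
  also have "\<dots> = (\<Sum>l<N. if i = l then \<Sum>c<k. S $$ (a, c) * v $ (l * k + c) else 0)"
    by (intro sum.cong) auto
  also have "\<dots> = (\<Sum>c<k. S $$ (a, c) * v $ (i * k + c))"
    using i by simp
  also have "\<dots> = (S *\<^sub>v vec_block k v i) $ a"
    using S a by (subst mult_mat_vec_index_sum[of _ k k]) (auto simp: vec_block_def)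
  finally show "vec_block k (diag_block_mat (replicate N S) *\<^sub>v v) i $ a =
      (S *\<^sub>v vec_block k v i) $ a"
    using a by (simp add: vec_block_def)
qed (use S in \<open>auto simp: vec_block_def\<close>)

lemma transpose_mult_vec_blocks:
  assumes M: "M \<in> carrier_mat (k * N) c" and v: "v \<in> carrier_vec (k * N)" and r: "r < c"
  shows "(M\<^sup>T *\<^sub>v v) $ r =
    (\<Sum>i<N. ((row_block M (i * k) ((i + 1) * k))\<^sup>T *\<^sub>v vec_block k v i) $ r)"
proof -
  have "(M\<^sup>T *\<^sub>v v) $ r = (\<Sum>j<k * N. M\<^sup>T $$ (r, j) * v $ j)"
    using assms by (intro mult_mat_vec_index_sum) auto
  also have "\<dots> = (\<Sum>j<k * N. M $$ (j, r) * v $ j)"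
    using M r by (intro sum.cong) auto
  also have "\<dots> = (\<Sum>i<N. ((row_block M (i * k) ((i + 1) * k))\<^sup>T *\<^sub>v vec_block k v i) $ r)"
    unfolding sum_lessThan_blocks
  proof (rule sum.cong[OF refl])
    fix i assume "i \<in> {..<N}"
    show "(\<Sum>j<k. M $$ (i * k + j, r) * v $ (i * k + j)) =
        ((row_block M (i * k) ((i + 1) * k))\<^sup>T *\<^sub>v vec_block k v i) $ r"
      using M r by (subst mult_mat_vec_index_sum[of _ c k])
        (auto simp: row_block_def vec_block_def)
  qed
  finally show ?thesis .
qed

section \<open>Vectorization\<close>

text \<open>The identity \<open>vec (B S y) = (y\<^sup>T \<otimes> B) vec S\<close> for a vector \<open>y\<close>; it is what makes products
  with an unknown matrix \<open>S\<close> linear in the entries of \<open>S\<close>.\<close>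

lemma kronecker_row_vector_mult_vectorize:
  fixes B S :: "'a::comm_semiring_0 mat"
  assumes B: "B \<in> carrier_mat nr a" and S: "S \<in> carrier_mat a b" and y: "y \<in> carrier_vec b"
  shows "(row_vector y \<otimes>\<^sub>K B) *\<^sub>v vectorize S = B *\<^sub>v (S *\<^sub>v y)"
proof (rule eq_vecI)
  fix r assume "r < dim_vec (B *\<^sub>v (S *\<^sub>v y))"
  then have r: "r < nr" using B by simp
  have K: "row_vector y \<otimes>\<^sub>K B \<in> carrier_mat nr (a * b)"
    using B y by (auto simp: kronecker_def row_vector_def mult.commute)
  have vS: "vectorize S \<in> carrier_vec (a * b)"
    using S by (auto simp: vectorize_def)
  have "((row_vector y \<otimes>\<^sub>K B) *\<^sub>v vectorize S) $ r =
      (\<Sum>c<a * b. (row_vector y \<otimes>\<^sub>K B) $$ (r, c) * vectorize S $ c)"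
    using K vS r by (rule mult_mat_vec_index_sum)
  also have "\<dots> = (\<Sum>c<a * b. y $ (c div a) * B $$ (r, c mod a) * S $$ (c mod a, c div a))"
  proof (rule sum.cong[OF refl])
    fix c assume "c \<in> {..<a * b}"
    then have "c < a * b" "c div a < b"
      by (auto simp: less_mult_imp_div_less mult.commute)
    then show "(row_vector y \<otimes>\<^sub>K B) $$ (r, c) * vectorize S $ c =
        y $ (c div a) * B $$ (r, c mod a) * S $$ (c mod a, c div a)"
      using B S y r
      by (auto simp: kronecker_def row_vector_def vectorize_def mult.commute[of b a]
          mat_of_rows_index)
  qed
  also have "\<dots> = (\<Sum>j<b. \<Sum>i<a. B $$ (r, i) * (S $$ (i, j) * y $ j))"
    unfolding sum_lessThan_blocks by (intro sum.cong refl) (auto simp: ac_simps)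
  also have "\<dots> = (\<Sum>i<a. B $$ (r, i) * (\<Sum>j<b. S $$ (i, j) * y $ j))"
    by (subst sum.swap) (simp add: sum_distrib_left)
  also have "\<dots> = (\<Sum>i<a. B $$ (r, i) * (S *\<^sub>v y) $ i)"
    using S y by (intro sum.cong refl, subst mult_mat_vec_index_sum[of S a b y]) auto
  also have "\<dots> = (B *\<^sub>v (S *\<^sub>v y)) $ r"
    using B S y r by (subst mult_mat_vec_index_sum[of B nr a]) auto
  finally show "((row_vector y \<otimes>\<^sub>K B) *\<^sub>v vectorize S) $ r = (B *\<^sub>v (S *\<^sub>v y)) $ r" .
qed (use B in \<open>auto simp: kronecker_def row_vector_def\<close>)

lemma mat_sum_mult_vec:
  fixes F :: "nat \<Rightarrow> 'a::comm_semiring_0 mat"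
  assumes F: "\<And>k. k < N \<Longrightarrow> F k \<in> carrier_mat nr nc" and v: "v \<in> carrier_vec nc" and r: "r < nr"
  shows "(mat_sum nr nc F N *\<^sub>v v) $ r = (\<Sum>k<N. (F k *\<^sub>v v) $ r)"
proof -
  have "(mat_sum nr nc F N *\<^sub>v v) $ r = (\<Sum>j<nc. mat_sum nr nc F N $$ (r, j) * v $ j)"
    using v r by (intro mult_mat_vec_index_sum) (auto simp: mat_sum_def)
  also have "\<dots> = (\<Sum>j<nc. \<Sum>k<N. F k $$ (r, j) * v $ j)"
    using r by (intro sum.cong) (auto simp: mat_sum_def sum_distrib_right)
  also have "\<dots> = (\<Sum>k<N. \<Sum>j<nc. F k $$ (r, j) * v $ j)"
    by (rule sum.swap)
  also have "\<dots> = (\<Sum>k<N. (F k *\<^sub>v v) $ r)"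
    using F v r by (intro sum.cong refl mult_mat_vec_index_sum[symmetric]) auto
  finally show ?thesis .
qed

text \<open>Both \<open>\<Phi>\<^sub>y\<close> and \<open>\<Phi>\<^sub>u\<close> are instances of the sum on the left: \<open>M\<close> is \<open>K\<^sub>f\<close> for the former and
  the identity for the latter. Multiplying by \<open>M\<^sup>T\<close> sums over the row blocks of \<open>M\<close>, and the block
  diagonal matrix acts on each block of \<open>v\<close> by the same \<open>S\<close>, so the vectorization identity applies
  to each summand.\<close>

lemma sum_kronecker_mult_vectorize:
  fixes M S :: "'a::comm_semiring_0 mat"
  assumes M: "M \<in> carrier_mat (k * N) c" and S: "S \<in> carrier_mat k k"
    and v: "v \<in> carrier_vec (k * N)"
  shows "mat_sum c (k * k)
      (\<lambda>i. row_vector (vec_block k v i) \<otimes>\<^sub>K (row_block M (i * k) ((i + 1) * k))\<^sup>T) N *\<^sub>v vectorize S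
    = M\<^sup>T *\<^sub>v (diag_block_mat (replicate N S) *\<^sub>v v)"
    (is "mat_sum c (k * k) ?F N *\<^sub>v _ = _")
proof (rule eq_vecI)
  let ?w = "diag_block_mat (replicate N S) *\<^sub>v v"
  let ?B = "\<lambda>i. (row_block M (i * k) ((i + 1) * k))\<^sup>T"
  fix r assume "r < dim_vec (M\<^sup>T *\<^sub>v ?w)"
  then have r: "r < c" using M by simp
  have B: "?B i \<in> carrier_mat c k" for i
    using M by (auto simp: row_block_def)
  have w: "?w \<in> carrier_vec (k * N)"
    using diag_block_mat_replicate_carrier[OF S] v by (rule mult_mat_vec_carrier)
  have "(mat_sum c (k * k) ?F N *\<^sub>v vectorize S) $ r = (\<Sum>i<N. (?F i *\<^sub>v vectorize S) $ r)"
    using M S r by (intro mat_sum_mult_vec)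
      (auto simp: kronecker_def row_vector_def row_block_def vec_block_def vectorize_def)
  also have "\<dots> = (\<Sum>i<N. (?B i *\<^sub>v vec_block k ?w i) $ r)"
  proof (rule sum.cong[OF refl])
    fix i assume i: "i \<in> {..<N}"
    have "?F i *\<^sub>v vectorize S = ?B i *\<^sub>v (S *\<^sub>v vec_block k v i)"
      using B S by (rule kronecker_row_vector_mult_vectorize) (simp add: vec_block_def)
    also have "S *\<^sub>v vec_block k v i = vec_block k ?w i"
      using diag_block_mat_replicate_mult_block[OF S v] i by simp
    finally show "(?F i *\<^sub>v vectorize S) $ r = (?B i *\<^sub>v vec_block k ?w i) $ r"
      by simp
  qed
  also have "\<dots> = (M\<^sup>T *\<^sub>v ?w) $ r"
    using transpose_mult_vec_blocks[OF M w r] by simp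
  finally show "(mat_sum c (k * k) ?F N *\<^sub>v vectorize S) $ r = (M\<^sup>T *\<^sub>v ?w) $ r" .
qed (use M in \<open>simp add: mat_sum_def\<close>)

lemma vech_carrier: "S \<in> carrier_mat k k \<Longrightarrow> vech S \<in> carrier_vec (k * (k + 1) div 2)"
  by (rule carrier_vecI) (simp add: vech_def length_vech_index)

lemma vech_smult: "S \<in> carrier_mat k k \<Longrightarrow> vech (c \<cdot>\<^sub>m S) = c \<cdot>\<^sub>v vech S"
proof (rule eq_vecI)
  fix i assume S: "S \<in> carrier_mat k k" and "i < dim_vec (c \<cdot>\<^sub>v vech S)"
  then have i: "i < length (vech_index k)" by (simp add: vech_def)
  obtain a b where ab: "vech_index k ! i = (a, b)" by fastforce
  then have "a < k" "b < k" using nth_mem[OF i] by (auto simp: set_vech_index)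
  then show "vech (c \<cdot>\<^sub>m S) $ i = (c \<cdot>\<^sub>v vech S) $ i"
    using i ab S by (simp add: vech_def vec_of_list_index)
qed (simp add: vech_def)

lemma vectorize_inject:
  assumes S: "S \<in> carrier_mat k l" and S': "S' \<in> carrier_mat k l"
    and eq: "vectorize S = vectorize S'"
  shows "S = S'"
proof (rule eq_matI)
  fix i j assume "i < dim_row S'" "j < dim_col S'"
  then have ij: "i < k" "j < l" using S' by auto
  then have "j * k + i < k * l" by (intro block_index_less)
  moreover have "vectorize S $ (j * k + i) = vectorize S' $ (j * k + i)" using eq by simp
  ultimately show "S $$ (i, j) = S' $$ (i, j)"
    using ij S S' by (simp add: vectorize_def)
qed (use S S' in auto)

lemma vech_inject_symmetric:
  fixes S S' :: "'a::comm_semiring_1 mat"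
  assumes "S \<in> carrier_mat k k" "S\<^sup>T = S" "S' \<in> carrier_mat k k" "S'\<^sup>T = S'"
    and "vech S = vech S'"
  shows "S = S'"
  using assms by (metis duplication_mat_vech vectorize_inject)

section \<open>The optimality condition as a kernel equation\<close>

lemma append_cols_mult_append_vec:
  fixes A B :: "'a::comm_ring_1 mat"
  assumes A: "A \<in> carrier_mat nr nc1" and B: "B \<in> carrier_mat nr nc2"
    and a: "a \<in> carrier_vec nc1" and b: "b \<in> carrier_vec nc2"
  shows "(A @\<^sub>c B) *\<^sub>v (a @\<^sub>v b) = A *\<^sub>v a + B *\<^sub>v b"
proof -
  have "(A @\<^sub>c B) *\<^sub>v (a @\<^sub>v b) =
      (A *\<^sub>v a + B *\<^sub>v b) @\<^sub>v (0\<^sub>m 0 nc1 *\<^sub>v a + 0\<^sub>m 0 nc2 *\<^sub>v b)"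
    unfolding append_cols_def using assms by (subst four_block_mat_mult_vec) auto
  then show ?thesis by (auto intro!: eq_vecI simp: A B)
qed

lemma Phi_tilde_mult_vech:
  assumes Kf: "Kf \<in> carrier_mat (p * N) (m * N)"
    and u: "u \<in> carrier_vec (m * N)" and y: "y \<in> carrier_vec (p * N)"
    and Q: "Q \<in> carrier_mat p p" "Q\<^sup>T = Q" and R: "R \<in> carrier_mat m m" "R\<^sup>T = R"
  shows "Phi_tilde m p N Kf y u *\<^sub>v (vech Q @\<^sub>v vech R) =
    Kf\<^sup>T *\<^sub>v (diag_block_mat (replicate N Q) *\<^sub>v y) + diag_block_mat (replicate N R) *\<^sub>v u"
proof -
  let ?Dp = "duplication_mat p :: real mat" and ?Dm = "duplication_mat m :: real mat"
  let ?P = "Phi_y m p N Kf y" and ?U = "Phi_u m N u"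
  let ?D = "diag_block_mat [?Dp, ?Dm]"
  define np where "np = p * (p + 1) div 2"
  define nm where "nm = m * (m + 1) div 2"
  have Dp: "?Dp \<in> carrier_mat (p * p) np" and Dm: "?Dm \<in> carrier_mat (m * m) nm"
    unfolding np_def nm_def by (rule duplication_mat_carrier)+
  have P: "?P \<in> carrier_mat (m * N) (p * p)" and U: "?U \<in> carrier_mat (m * N) (m * m)"
    by (auto simp: Phi_y_def Phi_u_def mat_sum_def)
  have PU: "?P @\<^sub>c ?U \<in> carrier_mat (m * N) (p * p + m * m)"
    using P U by (auto simp: append_cols_def)
  have D_eq: "?D = four_block_mat ?Dp (0\<^sub>m (p * p) nm) (0\<^sub>m (m * m) np) ?Dm"
    unfolding diag_block_mat.simps(2)[of _ "[?Dm]"] diag_block_mat_singleton Let_def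
    using Dp Dm by auto
  have D: "?D \<in> carrier_mat (p * p + m * m) (np + nm)"
    unfolding D_eq using Dp Dm by (rule four_block_carrier_mat)
  have vQ: "vech Q \<in> carrier_vec np" and vR: "vech R \<in> carrier_vec nm"
    unfolding np_def nm_def by (rule vech_carrier[OF Q(1)] vech_carrier[OF R(1)])+
  have D_mult: "?D *\<^sub>v (vech Q @\<^sub>v vech R) = vectorize Q @\<^sub>v vectorize R"
  proof -
    have "?D *\<^sub>v (vech Q @\<^sub>v vech R) =
        (?Dp *\<^sub>v vech Q + 0\<^sub>m (p * p) nm *\<^sub>v vech R) @\<^sub>v
        (0\<^sub>m (m * m) np *\<^sub>v vech Q + ?Dm *\<^sub>v vech R)"
      unfolding D_eq using Dp Dm vQ vR by (intro four_block_mat_mult_vec) auto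
    also have "\<dots> = (?Dp *\<^sub>v vech Q) @\<^sub>v (?Dm *\<^sub>v vech R)"
      using Dp Dm vQ vR by (intro arg_cong2[of _ _ _ _ "(@\<^sub>v)"] eq_vecI) auto
    also have "\<dots> = vectorize Q @\<^sub>v vectorize R"
      using Q R by (simp add: duplication_mat_vech)
    finally show ?thesis .
  qed
  have "Phi_tilde m p N Kf y u *\<^sub>v (vech Q @\<^sub>v vech R) =
      (?P @\<^sub>c ?U) *\<^sub>v (?D *\<^sub>v (vech Q @\<^sub>v vech R))"
    unfolding Phi_tilde_def using PU D vQ vR by (intro assoc_mult_mat_vec) auto
  also have "\<dots> = ?P *\<^sub>v vectorize Q + ?U *\<^sub>v vectorize R"
    unfolding D_mult using P U Q R
    by (intro append_cols_mult_append_vec) (auto simp: vectorize_def)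
  also have "?P *\<^sub>v vectorize Q = Kf\<^sup>T *\<^sub>v (diag_block_mat (replicate N Q) *\<^sub>v y)"
    unfolding Phi_y_def using Kf Q(1) y by (rule sum_kronecker_mult_vectorize)
  also have "?U *\<^sub>v vectorize R =
      (1\<^sub>m (m * N))\<^sup>T *\<^sub>v (diag_block_mat (replicate N R) *\<^sub>v u)"
    unfolding Phi_u_def using one_carrier_mat R(1) u by (rule sum_kronecker_mult_vectorize)
  also have "\<dots> = diag_block_mat (replicate N R) *\<^sub>v u"
    using mult_mat_vec_carrier[OF diag_block_mat_replicate_carrier[OF R(1)] u] by simp
  finally show ?thesis .
qed

lemma transpose_diag_block_mat_replicate:
  assumes S: "S \<in> carrier_mat k k" and sym: "S\<^sup>T = S"
  shows "(diag_block_mat (replicate N S))\<^sup>T = diag_block_mat (replicate N S)"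
proof (rule eq_matI)
  let ?D = "diag_block_mat (replicate N S)"
  have D: "?D \<in> carrier_mat (k * N) (k * N)" using S by simp
  fix i j assume "i < dim_row ?D" "j < dim_col ?D"
  then have ij: "i < k * N" "j < k * N" using D by auto
  then have "i mod k < k" "j mod k < k" by (cases k; simp)+
  then have "S $$ (j mod k, i mod k) = S $$ (i mod k, j mod k)"
    using S sym by (metis carrier_matD index_transpose_mat(1))
  then show "?D\<^sup>T $$ (i, j) = ?D $$ (i, j)"
    using ij carrier_matD[OF D] S by (auto simp: diag_block_mat_replicate_index)
qed (use diag_block_mat_replicate_carrier[OF S, of N] in auto)

text \<open>The output estimate at which \<open>\<Phi>\<close> is evaluated is exactly the vector that \<open>K\<^sub>f\<^sup>T \<Q>\<close> is applied
  to once the two terms containing \<open>\<Q>\<close> are collected. This needs \<open>\<Q>\<^sup>T = \<Q>\<close>.\<close>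

lemma optimality_condition_iff_mat_kernel:
  assumes Kf: "Kf \<in> carrier_mat (p * N) (m * N)" and Kp: "Kp \<in> carrier_mat (p * N) q"
    and u: "u \<in> carrier_vec (m * N)" and z: "z \<in> carrier_vec q"
    and Q: "Q \<in> carrier_mat p p" "Q\<^sup>T = Q" and R: "R \<in> carrier_mat m m" "R\<^sup>T = R"
  shows "optimality_condition N Kp Kf u z Q R \<longleftrightarrow>
    vech Q @\<^sub>v vech R \<in> mat_kernel (Phi_tilde m p N Kf (Kf *\<^sub>v u + Kp *\<^sub>v z) u)"
proof -
  let ?Q = "diag_block_mat (replicate N Q)" and ?R = "diag_block_mat (replicate N R)"
  let ?y = "Kf *\<^sub>v u + Kp *\<^sub>v z"
  have DQ: "?Q \<in> carrier_mat (p * N) (p * N)" and DR: "?R \<in> carrier_mat (m * N) (m * N)"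
    using Q R by auto
  have KfT: "Kf\<^sup>T \<in> carrier_mat (m * N) (p * N)" using Kf by simp
  have KQ: "Kf\<^sup>T * ?Q \<in> carrier_mat (m * N) (p * N)" using KfT DQ by simp
  have Ku: "Kf *\<^sub>v u \<in> carrier_vec (p * N)" and Kz: "Kp *\<^sub>v z \<in> carrier_vec (p * N)"
    using Kf Kp u z by auto
  have KQu: "Kf\<^sup>T * ?Q * Kf *\<^sub>v u = Kf\<^sup>T * ?Q *\<^sub>v (Kf *\<^sub>v u)"
    using KQ Kf u by (rule assoc_mult_mat_vec)
  have KQz: "Kf\<^sup>T * ?Q * Kp *\<^sub>v z = Kf\<^sup>T * ?Q *\<^sub>v (Kp *\<^sub>v z)"
    using KQ Kp z by (rule assoc_mult_mat_vec)
  have KQy: "Kf\<^sup>T * ?Q *\<^sub>v ?y = Kf\<^sup>T *\<^sub>v (?Q *\<^sub>v ?y)"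
    using KfT DQ by (rule assoc_mult_mat_vec) (use Ku Kz in simp)
  have Ru: "?R *\<^sub>v u \<in> carrier_vec (m * N)"
    using DR u by (rule mult_mat_vec_carrier)
  have KQKu: "Kf\<^sup>T * ?Q *\<^sub>v (Kf *\<^sub>v u) \<in> carrier_vec (m * N)"
    and KQKz: "Kf\<^sup>T * ?Q *\<^sub>v (Kp *\<^sub>v z) \<in> carrier_vec (m * N)"
    using KQ Ku Kz by (auto intro: mult_mat_vec_carrier)
  have "(Kf\<^sup>T * ?Q * Kf + ?R) *\<^sub>v u + (Kf\<^sup>T * ?Q\<^sup>T * Kp) *\<^sub>v z =
      Kf\<^sup>T * ?Q * Kf *\<^sub>v u + ?R *\<^sub>v u + Kf\<^sup>T * ?Q * Kp *\<^sub>v z"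
    using add_mult_distrib_mat_vec[OF mult_carrier_mat[OF KQ Kf] DR u]
    by (simp add: transpose_diag_block_mat_replicate[OF Q])
  also have "\<dots> = Kf\<^sup>T * ?Q *\<^sub>v (Kf *\<^sub>v u) + Kf\<^sup>T * ?Q *\<^sub>v (Kp *\<^sub>v z) + ?R *\<^sub>v u"
    unfolding KQu KQz assoc_add_vec[OF KQKu Ru KQKz] assoc_add_vec[OF KQKu KQKz Ru]
      comm_add_vec[OF Ru KQKz] ..
  also have "\<dots> = Kf\<^sup>T *\<^sub>v (?Q *\<^sub>v ?y) + ?R *\<^sub>v u"
    unfolding KQy[symmetric] mult_add_distrib_mat_vec[OF KQ Ku Kz] ..
  also have "\<dots> = Phi_tilde m p N Kf ?y u *\<^sub>v (vech Q @\<^sub>v vech R)"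
    using Ku Kz by (intro Phi_tilde_mult_vech[symmetric] Kf u Q R) simp
  finally have "optimality_condition N Kp Kf u z Q R \<longleftrightarrow>
      Phi_tilde m p N Kf ?y u *\<^sub>v (vech Q @\<^sub>v vech R) = 0\<^sub>v (m * N)"
    using Kf by (simp add: optimality_condition_def)
  moreover have "vech Q @\<^sub>v vech R \<in> carrier_vec (p * (p + 1) div 2 + m * (m + 1) div 2)"
    using Q R by (intro append_carrier_vec vech_carrier)
  ultimately show ?thesis
    by (simp add: mat_kernel[OF Phi_tilde_carrier])
qed

section \<open>Weights on a common line\<close>

lemma kernel_dim_1_imp_proportional:
  fixes A :: "'a::field mat"
  assumes dim: "kernel_dim A = 1" and v: "v \<in> mat_kernel A" and w: "w \<in> mat_kernel A"
    and nz: "w \<noteq> 0\<^sub>v (dim_col A)"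
  shows "\<exists>c. v = c \<cdot>\<^sub>v w"
proof -
  have A: "A \<in> carrier_mat (dim_row A) (dim_col A)" by simp
  interpret K: kernel "dim_row A" "dim_col A" A by unfold_locales (rule A)
  obtain bs where bs: "finite bs" "K.basis bs" using kernel_basis_exists[OF A] by blast
  have "card bs = 1" using K.Ker.dim_basis[OF bs] dim by simp
  then obtain b where b: "bs = {b}" by (rule card_1_singletonE)
  have bK: "b \<in> mat_kernel A" and span: "K.span {b} = mat_kernel A"
    using bs(2) unfolding K.Ker.basis_def b by auto
  have multiple: "\<exists>c. x = c \<cdot>\<^sub>v b" if "x \<in> mat_kernel A" for x
  proof -
    have "x \<in> K.span {b}" using that span by simp
    then obtain f where "x = K.lincomb f {b}"
      using K.Ker.finite_in_span[of "{b}" x] bK by auto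
    then show ?thesis
      using bK mat_kernel_smult[OF A bK] by (auto simp: K.Ker.lincomb_def)
  qed
  obtain c d where c: "v = c \<cdot>\<^sub>v b" and d: "w = d \<cdot>\<^sub>v b"
    using multiple[OF v] multiple[OF w] by blast
  have "b \<in> carrier_vec (dim_col A)" using mat_kernelD(1)[OF A bK] .
  then have "d \<noteq> 0" using nz d by auto
  then have "v = (c / d) \<cdot>\<^sub>v w" unfolding c d by (intro eq_vecI) auto
  then show ?thesis by (rule exI)
qed

lemma sym_pos_def_smult_pos:
  assumes S: "sym_pos_def k S" and S': "sym_pos_def k S'" and eq: "S = \<alpha> \<cdot>\<^sub>m S'" and k: "k > 0"
  shows "\<alpha> > 0"
proof -
  let ?e = "unit_vec k 0 :: real vec"
  have e: "?e \<in> carrier_vec k" "?e \<noteq> 0\<^sub>v k" using k by auto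
  have S'c: "S' \<in> carrier_mat k k" using S' by (simp add: sym_pos_def_def)
  have "S *\<^sub>v ?e = \<alpha> \<cdot>\<^sub>v (S' *\<^sub>v ?e)"
    unfolding eq using S'c by (intro eq_vecI) auto
  then have "?e \<bullet> (S *\<^sub>v ?e) = \<alpha> * (?e \<bullet> (S' *\<^sub>v ?e))"
    using S'c e by (metis mult_mat_vec_carrier scalar_prod_smult_distrib)
  moreover have "?e \<bullet> (S *\<^sub>v ?e) > 0" "?e \<bullet> (S' *\<^sub>v ?e) > 0"
    using S S' e unfolding sym_pos_def_def by blast+
  ultimately show ?thesis by (simp add: zero_less_mult_iff)
qed

lemma sym_pos_def_vech_eq_0_imp:
  assumes S: "sym_pos_def k S" and "vech S = 0\<^sub>v (k * (k + 1) div 2)"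
  shows "k = 0"
proof (rule ccontr)
  assume "k \<noteq> 0"
  then have k: "k > 0" by simp
  have Sc: "S \<in> carrier_mat k k" "S\<^sup>T = S" using S by (auto simp: sym_pos_def_def)
  \<comment> \<open>Otherwise \<open>S\<close> would be 0 times a positive definite matrix, namely itself.\<close>
  have "vech S = vech (0 \<cdot>\<^sub>m S)"
    using assms(2) vech_smult[OF Sc(1), of 0] by (intro eq_vecI) auto
  then have "S = 0 \<cdot>\<^sub>m S"
    using Sc by (intro vech_inject_symmetric[of S k]) (auto intro!: eq_matI)
  then show False using sym_pos_def_smult_pos[OF S S _ k] by blast
qed

theorem theorem1:
  fixes n m p T Tini N :: nat
    and A B C D Q0 R0 Q R Q' R' Up Uf Yp Yf K Kp Kf :: "real mat"
    and x0 zini ut yes :: "real vec"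
    and ud yd uo yo :: "nat \<Rightarrow> real vec"
  assumes system: "minimal_lti_system n m p A B C D"
    and offline_data: "is_io_trajectory A B C D T ud yd"
    and U_def: "Up = row_block (hankel m (Tini + N) T ud) 0 (m * Tini)"
      "Uf = row_block (hankel m (Tini + N) T ud) (m * Tini) (m * (Tini + N))"
    and Y_def: "Yp = row_block (hankel p (Tini + N) T yd) 0 (p * Tini)"
      "Yf = row_block (hankel p (Tini + N) T yd) (p * Tini) (p * (Tini + N))"
    and rank_data:
      "vec_space.rank ((m + p) * (Tini + N)) (Up @\<^sub>r Yp @\<^sub>r Uf @\<^sub>r Yf) = m * (Tini + N) + n"
    and K_def: "K = Yf * pseudoinverse (Up @\<^sub>r Yp @\<^sub>r Uf)"
      "Kp = col_block K 0 ((m + p) * Tini)"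
      "Kf = col_block K ((m + p) * Tini) ((m + p) * Tini + m * N)"
    and true_weights: "sym_pos_def p Q0" "sym_pos_def m R0"
    and optimal_data: "is_optimal_trajectory A B C D Q0 R0 (Tini + N) x0 uo yo"
    and zini_def: "zini = stack m Tini uo @\<^sub>v stack p Tini yo"
    and ut_def: "ut = stack m N (\<lambda>k. uo (Tini + k))"
    and yes_def: "yes = Kf *\<^sub>v ut + Kp *\<^sub>v zini"
    and weights: "sym_pos_def p Q" "sym_pos_def m R"
    and weights': "sym_pos_def p Q'" "sym_pos_def m R'"
    and opt: "optimality_condition N Kp Kf ut zini Q R"
    and opt': "optimality_condition N Kp Kf ut zini Q' R'"
    and null_space: "kernel_dim (Phi_tilde m p N Kf yes ut) = 1"
  shows "\<exists>\<alpha>>0. Q = \<alpha> \<cdot>\<^sub>m Q' \<and> R = \<alpha> \<cdot>\<^sub>m R'"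
proof -
  \<comment> \<open>A product has as many rows as its left factor, here \<open>Yf\<close>, and a column block is as wide as
    its range of indices; this fixes the sizes of both predictors.\<close>
  have KfC: "Kf \<in> carrier_mat (p * N) (m * N)"
    and KpC: "Kp \<in> carrier_mat (p * N) ((m + p) * Tini)"
    using K_def Y_def by (auto simp: col_block_def row_block_def algebra_simps)
  have utC: "ut \<in> carrier_vec (m * N)"
    using ut_def by (simp add: stack_def)
  have ziniC: "zini \<in> carrier_vec ((m + p) * Tini)"
    unfolding zini_def carrier_vec_def by (simp add: stack_def algebra_simps)
  have Q: "Q \<in> carrier_mat p p" "Q\<^sup>T = Q" and R: "R \<in> carrier_mat m m" "R\<^sup>T = R"
    and Q': "Q' \<in> carrier_mat p p" "Q'\<^sup>T = Q'" and R': "R' \<in> carrier_mat m m" "R'\<^sup>T = R'"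
    using weights weights' by (auto simp: sym_pos_def_def)
  let ?Phi = "Phi_tilde m p N Kf yes ut"
  define np where "np = p * (p + 1) div 2"
  define nm where "nm = m * (m + 1) div 2"
  have Phi: "?Phi \<in> carrier_mat (m * N) (np + nm)"
    unfolding np_def nm_def by (rule Phi_tilde_carrier)
  have ker: "vech Q @\<^sub>v vech R \<in> mat_kernel ?Phi"
    using opt optimality_condition_iff_mat_kernel[OF KfC KpC utC ziniC Q R] by (simp add: yes_def)
  have ker': "vech Q' @\<^sub>v vech R' \<in> mat_kernel ?Phi"
    using opt' optimality_condition_iff_mat_kernel[OF KfC KpC utC ziniC Q' R'] by (simp add: yes_def)
  have vQ: "vech Q \<in> carrier_vec np" "vech Q' \<in> carrier_vec np"
    and vR: "vech R \<in> carrier_vec nm" "vech R' \<in> carrier_vec nm"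
    unfolding np_def nm_def using Q(1) Q'(1) R(1) R'(1) by (intro vech_carrier; simp)+
  \<comment> \<open>The sign of the scaling factor is read off a nonempty weight. For \<open>p = m = 0\<close> the matrix
    \<open>\<Phi>\<close> has no columns, hence a kernel of dimension 0.\<close>
  have dims: "p > 0 \<or> m > 0"
  proof (rule ccontr)
    assume "\<not> (p > 0 \<or> m > 0)"
    then have "dim_col ?Phi = 0" using Phi by (simp add: np_def nm_def)
    then show False using null_space by (simp add: kernel_dim_code)
  qed
  have "vech Q' @\<^sub>v vech R' \<noteq> 0\<^sub>v (np + nm)"
  proof
    assume "vech Q' @\<^sub>v vech R' = 0\<^sub>v (np + nm)"
    also have "\<dots> = 0\<^sub>v np @\<^sub>v 0\<^sub>v nm" by (intro eq_vecI) auto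
    finally have "vech Q' = 0\<^sub>v np" "vech R' = 0\<^sub>v nm"
      using append_vec_eq[OF vQ(2) zero_carrier_vec] by auto
    then show False
      using dims sym_pos_def_vech_eq_0_imp weights' unfolding np_def nm_def by blast
  qed
  then obtain \<alpha> where "vech Q @\<^sub>v vech R = \<alpha> \<cdot>\<^sub>v (vech Q' @\<^sub>v vech R')"
    using kernel_dim_1_imp_proportional[OF null_space ker ker'] Phi by auto
  also have "\<dots> = vech (\<alpha> \<cdot>\<^sub>m Q') @\<^sub>v vech (\<alpha> \<cdot>\<^sub>m R')"
    unfolding vech_smult[OF Q'(1)] vech_smult[OF R'(1)] by (intro eq_vecI) auto
  finally have vech_eq: "vech Q = vech (\<alpha> \<cdot>\<^sub>m Q')" "vech R = vech (\<alpha> \<cdot>\<^sub>m R')"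
    using append_vec_eq[OF vQ(1), of "vech (\<alpha> \<cdot>\<^sub>m Q')"] vQ(2) vech_smult[OF Q'(1)] by auto
  have transpose_smult: "(c \<cdot>\<^sub>m S)\<^sup>T = c \<cdot>\<^sub>m S\<^sup>T" for c :: real and S
    by (intro eq_matI) auto
  then have tr: "(\<alpha> \<cdot>\<^sub>m Q')\<^sup>T = \<alpha> \<cdot>\<^sub>m Q'" "(\<alpha> \<cdot>\<^sub>m R')\<^sup>T = \<alpha> \<cdot>\<^sub>m R'"
    using transpose_smult[of \<alpha> Q'] transpose_smult[of \<alpha> R'] Q'(2) R'(2) by auto
  have QR: "Q = \<alpha> \<cdot>\<^sub>m Q'" "R = \<alpha> \<cdot>\<^sub>m R'"
    using vech_inject_symmetric[OF Q _ tr(1) vech_eq(1)] vech_inject_symmetric[OF R _ tr(2) vech_eq(2)]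
      Q'(1) R'(1) by auto
  then have "\<alpha> > 0"
    using dims sym_pos_def_smult_pos weights weights' by blast
  with QR show ?thesis by blast
qed

end
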